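(* Let $M_0,M_1\in\mathbb{R}$ and $k\in\{0,\ldots,n-1\}$ be fixed. Suppose that for $j=0,1$ the problem $(P_{n,k}^{M_j})$ has a unique solution, and let $g_{n,k}[M_j]$ be the Green's function related to $(P_{n,k}^{M_j})$. Then the two following identities hold for all $t,s\in I$: $$g_{n,k}[M_1](t,s)=g_{n,k}[M_0](t,s)+(M_0-M_1)\int_a^b g_{n,k}[M_0](t,r)\,\frac{\partial^k}{\partial t^k}g_{n,k}[M_1](r,s)\,dr,$$ $$g_{n,k}[M_1](t,s)=g_{n,k}[M_0](t,s)+(M_0-M_1)\int_a^b g_{n,k}[M_1](t,r)\,\frac{\partial^k}{\partial t^k}g_{n,k}[M_0](r,s)\,dr.$$
   Context: Let $I=[a,b]$, $k\in\{0,\ldots,n-1\}$, $M\in\mathbb{R}$. Problem $(P_{n,k}^M)$ is: find $u\in C^n(I)$ with $T_{n,k}[M]u(t)=\sigma(t)$, $t\in I$, and $B_i(u)=0$, $i=1,\ldots,n$, where $T_{n,k}[M]u(t)=L_nu(t)+M\,u^{(k)}(t)$, $L_nu(t)=u^{(n)}(t)+a_1(t)u^{(n-1)}(t)+\cdots+a_n(t)u(t)$, $B_i(u)=\sum_{j=0}^{n-1}\bigl(\alpha^i_ju^{(j)}(a)+\beta^i_ju^{(j)}(b)\bigr)$, with real constants $\alpha^i_j,\beta^i_j$ and $\sigma,a_1,\ldots,a_n\in C(I)$. "$(P_{n,k}^M)$ has a unique solution" means that it has exactly one solution for every $\sigma\in C(I)$; this is equivalent to the homogeneous problem ($\sigma=0$)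 having only the trivial solution. The Green's function of $(P_{n,k}^M)$ is $g_{n,k}[M]\in C^{n-2}(I\times I)\cap C^n((I\times I)\setminus\{(t,t):t\in I\})$ which is, for each fixed $s\in(a,b)$, the unique solution of $T_{n,k}[M](g_{n,k}[M](t,s))=0$ for $t\in I\setminus\{s\}$, $B_i(g_{n,k}[M](\cdot,s))=0$, $i=1,\ldots,n$, and which satisfies: for each $t\in(a,b)$ the following lateral limits exist, are finite, and fulfil, with $h=\frac{\partial^{n-1}}{\partial t^{n-1}}g_{n,k}[M]$, $h(t^-,t)=h(t,t^+)$, $h(t,t^-)=h(t^+,t)$ and $h(t^+,t)-h(t^-,t)=h(t,t^-)-h(t,t^+)=1$, where $h(t^{\pm},t)=\lim_{r\to t^\pm}h(r,t)$ and $h(t,t^\pm)=\lim_{r\to t^\pm}h(t,r)$. If $(P_{n,k}^M)$ has a unique solution, that solution is $u(t)=\int_a^b g_{n,k}[M](t,s)\sigma(s)\,ds$. $\frac{\partial^k}{\partial t^k}g_{n,k}[M](r,s)$ denotes the $k$-th partial derivative with respect to the first variable, evaluated at $(r,s)$.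
   Formalization: For n = 1 the identities are proved only for t ≠ s, because the definition of the Green's function then prescribes no value on the diagonal t = s, where it jumps; for n ≥ 2 they are proved for all t, s in I. *)

theory Defs
  imports "HOL-Analysis.Analysis"
begin

text \<open>The iterated derivative relative to \<open>S\<close>.  For \<open>S = {a..b}\<close> with \<open>a < b\<close> this is the ordinary
  derivative at interior points and the one-sided derivative at the endpoints; it only depends on
  the values of the function on \<open>S\<close>.  Where the derivative does not exist the value is unspecified.\<close>

primrec nderiv :: "real set \<Rightarrow> nat \<Rightarrow> (real \<Rightarrow> real) \<Rightarrow> real \<Rightarrow> real" where
  "nderiv S 0 f = f"
| "nderiv S (Suc j) f = (\<lambda>t. vector_derivative (nderiv S j f) (at t within S))"

definition Cn_on :: "nat \<Rightarrow> real set \<Rightarrow> (real \<Rightarrow> real) \<Rightarrow> bool" where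
  "Cn_on m S u \<longleftrightarrow>
     (\<forall>j<m. \<forall>t\<in>S. nderiv S j u differentiable (at t within S)) \<and>
     (\<forall>j\<le>m. continuous_on S (nderiv S j u))"

text \<open>The operator \<open>T\<^sub>n\<^sub>,\<^sub>k[M] u = u\<^sup>(\<^sup>n\<^sup>) + c\<^sub>1 u\<^sup>(\<^sup>n\<^sup>-\<^sup>1\<^sup>) + \<dots> + c\<^sub>n u + M u\<^sup>(\<^sup>k\<^sup>)\<close> on \<open>[a,b]\<close>, and the boundary
  forms \<open>B\<^sub>i\<close>.  Only \<open>c i\<close> with \<open>1 \<le> i \<le> n\<close> and \<open>\<alpha> i j\<close>, \<open>\<beta> i j\<close> with
  \<open>1 \<le> i \<le> n\<close>, \<open>j < n\<close> are relevant.\<close>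

definition L_op :: "real \<Rightarrow> real \<Rightarrow> nat \<Rightarrow> (nat \<Rightarrow> real \<Rightarrow> real) \<Rightarrow> (real \<Rightarrow> real) \<Rightarrow> real \<Rightarrow> real" where
  "L_op a b n c u t =
     nderiv {a..b} n u t + (\<Sum>i=1..n. c i t * nderiv {a..b} (n - i) u t)"

definition T_op :: "real \<Rightarrow> real \<Rightarrow> nat \<Rightarrow> (nat \<Rightarrow> real \<Rightarrow> real) \<Rightarrow> nat \<Rightarrow> real
    \<Rightarrow> (real \<Rightarrow> real) \<Rightarrow> real \<Rightarrow> real" where
  "T_op a b n c k M u t = L_op a b n c u t + M * nderiv {a..b} k u t"

definition B_form :: "real \<Rightarrow> real \<Rightarrow> nat \<Rightarrow> (nat \<Rightarrow> nat \<Rightarrow> real) \<Rightarrow> (nat \<Rightarrow> nat \<Rightarrow> real)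
    \<Rightarrow> nat \<Rightarrow> (real \<Rightarrow> real) \<Rightarrow> real" where
  "B_form a b n \<alpha> \<beta> i u =
     (\<Sum>j<n. \<alpha> i j * nderiv {a..b} j u a + \<beta> i j * nderiv {a..b} j u b)"

definition bvp_solution :: "real \<Rightarrow> real \<Rightarrow> nat \<Rightarrow> (nat \<Rightarrow> real \<Rightarrow> real)
    \<Rightarrow> (nat \<Rightarrow> nat \<Rightarrow> real) \<Rightarrow> (nat \<Rightarrow> nat \<Rightarrow> real) \<Rightarrow> nat \<Rightarrow> real
    \<Rightarrow> (real \<Rightarrow> real) \<Rightarrow> (real \<Rightarrow> real) \<Rightarrow> bool" where
  "bvp_solution a b n c \<alpha> \<beta> k M \<sigma> u \<longleftrightarrow>
     Cn_on n {a..b} u \<and>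
     (\<forall>t\<in>{a..b}. T_op a b n c k M u t = \<sigma> t) \<and>
     (\<forall>i\<in>{1..n}. B_form a b n \<alpha> \<beta> i u = 0)"

text \<open>Solutions are functions on \<open>[a,b]\<close>, hence uniqueness means agreement on \<open>[a,b]\<close>.\<close>

definition bvp_uniquely_solvable :: "real \<Rightarrow> real \<Rightarrow> nat \<Rightarrow> (nat \<Rightarrow> real \<Rightarrow> real)
    \<Rightarrow> (nat \<Rightarrow> nat \<Rightarrow> real) \<Rightarrow> (nat \<Rightarrow> nat \<Rightarrow> real) \<Rightarrow> nat \<Rightarrow> real \<Rightarrow> bool" where
  "bvp_uniquely_solvable a b n c \<alpha> \<beta> k M \<longleftrightarrow>
     (\<forall>\<sigma>. continuous_on {a..b} \<sigma> \<longrightarrow>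
        (\<exists>u. bvp_solution a b n c \<alpha> \<beta> k M \<sigma> u) \<and>
        (\<forall>u v. bvp_solution a b n c \<alpha> \<beta> k M \<sigma> u \<longrightarrow> bvp_solution a b n c \<alpha> \<beta> k M \<sigma> v \<longrightarrow>
           (\<forall>t\<in>{a..b}. u t = v t)))"

definition dt :: "real \<Rightarrow> real \<Rightarrow> nat \<Rightarrow> (real \<Rightarrow> real \<Rightarrow> real) \<Rightarrow> real \<Rightarrow> real \<Rightarrow> real" where
  "dt a b j g t s = nderiv {a..b} j (\<lambda>r. g r s) t"

text \<open>Smoothness class of a Green's function on \<open>A \<subseteq> [a,b] \<times> [a,b]\<close>: the derivatives with respect to
  the first variable up to order \<open>m\<close> exist on \<open>A\<close> and are jointly continuous there.  Derivatives in
  \<open>s\<close> are not required: with coefficients that are merely continuous a Green's function is in general not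
  \<open>n\<close> times differentiable in \<open>s\<close>.\<close>

definition Ct_on :: "real \<Rightarrow> real \<Rightarrow> nat \<Rightarrow> (real \<times> real) set \<Rightarrow> (real \<Rightarrow> real \<Rightarrow> real) \<Rightarrow> bool" where
  "Ct_on a b m A g \<longleftrightarrow>
     (\<forall>j<m. \<forall>(t, s)\<in>A. (\<lambda>r. dt a b j g r s) differentiable (at t within {a..b})) \<and>
     (\<forall>j\<le>m. continuous_on A (\<lambda>(t, s). dt a b j g t s))"

text \<open>In the last clause, with \<open>h\<close> the derivative of order \<open>n - 1\<close> in the first variable,
  \<open>l\<close> is the common value of \<open>h(t\<^sup>-,t)\<close> and \<open>h(t,t\<^sup>+)\<close>, and \<open>l'\<close> that of \<open>h(t\<^sup>+,t)\<close> and
  \<open>h(t,t\<^sup>-)\<close>.  For \<open>n = 1\<close> nothing is required of \<open>g\<close> on the diagonal.\<close>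

definition is_green :: "real \<Rightarrow> real \<Rightarrow> nat \<Rightarrow> (nat \<Rightarrow> real \<Rightarrow> real)
    \<Rightarrow> (nat \<Rightarrow> nat \<Rightarrow> real) \<Rightarrow> (nat \<Rightarrow> nat \<Rightarrow> real) \<Rightarrow> nat \<Rightarrow> real
    \<Rightarrow> (real \<Rightarrow> real \<Rightarrow> real) \<Rightarrow> bool" where
  "is_green a b n c \<alpha> \<beta> k M g \<longleftrightarrow>
     (n \<ge> 2 \<longrightarrow> Ct_on a b (n - 2) ({a..b} \<times> {a..b}) g) \<and>
     Ct_on a b n ({a..b} \<times> {a..b} - {(t, t) |t. t \<in> {a..b}}) g \<and>
     (\<forall>s\<in>{a<..<b}.
        (\<forall>t\<in>{a..b} - {s}. T_op a b n c k M (\<lambda>r. g r s) t = 0) \<and>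
        (\<forall>i\<in>{1..n}. B_form a b n \<alpha> \<beta> i (\<lambda>r. g r s) = 0)) \<and>
     (\<forall>t\<in>{a<..<b}. \<exists>l l'.
        ((\<lambda>r. dt a b (n - 1) g r t) \<longlongrightarrow> l) (at_left t) \<and>
        ((\<lambda>r. dt a b (n - 1) g t r) \<longlongrightarrow> l) (at_right t) \<and>
        ((\<lambda>r. dt a b (n - 1) g r t) \<longlongrightarrow> l') (at_right t) \<and>
        ((\<lambda>r. dt a b (n - 1) g t r) \<longlongrightarrow> l') (at_left t) \<and>
        l' - l = 1)"

end

theory Submission
  imports Defs
begin

text \<open>Fix \<open>s\<close> and write \<open>\<phi>(r) = \<partial>\<^sup>k g1(r, s) / \<partial>t\<^sup>k\<close>.  Since \<open>T\<^sub>n\<^sub>,\<^sub>k[M0] - T\<^sub>n\<^sub>,\<^sub>k[M1]\<close> is \<open>M0 - M1\<close> times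
  the \<open>k\<close>-th derivative, the function \<open>u = g1(\<cdot>, s) - g0(\<cdot>, s)\<close> satisfies \<open>T\<^sub>n\<^sub>,\<^sub>k[M0] u = (M0 - M1) \<phi>\<close> away
  from \<open>s\<close>, together with the boundary conditions, and its derivative of order \<open>n - 1\<close> extends
  continuously to \<open>s\<close> because the two unit jumps cancel.  The potential \<open>v(t) = \<integral> g0(t, r) \<phi>(r) dr\<close> satisfies
  \<open>T\<^sub>n\<^sub>,\<^sub>k[M0] v = \<phi>\<close> and the same boundary conditions.  Unique solvability for \<open>M0\<close> gives
  \<open>u = (M0 - M1) v\<close>, the first identity.  Exchanging \<open>M0\<close> and \<open>M1\<close> gives the second.

  Two points need care.  First, \<open>\<phi>\<close> jumps at \<open>s\<close> when \<open>k = n - 1\<close>, so \<open>v\<close> need not have a continuous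
  \<open>n\<close>-th derivative.  All equations are therefore integrated: a system of increments
  \<open>z\<^sub>j(t) - z\<^sub>j(a) = \<integral> z\<^sub>j\<^sub>+\<^sub>1\<close> is insensitive to a single point, and
  \<open>zero_of_homogeneous_integral_system\<close> turns such a system for \<open>u - (M0 - M1) v\<close> back into a classical
  solution.  For a Green's function the increments contain the unit step at \<open>s\<close> (\<open>D_increment\<close>), and
  integrating them against \<open>\<phi>\<close> with Fubini's theorem gives those of the potential
  (\<open>potential_increment\<close>).

  Second, Fubini's theorem and limits in \<open>s\<close> need bounds for the derivatives up to the diagonal and up to
  its corners.  The definition only provides lateral limits at interior points of the diagonal, but the
  derivatives solve a linear system, so Gronwall's inequality carries the bound from an edge of the square
  that is far from the diagonal to the whole section (\<open>D_propagation_bound\<close>, \<open>D_bounded\<close>).  The identity is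
  first obtained for \<open>s\<close> inside the interval and \<open>t \<noteq> s\<close>, and extended to the endpoints and, for
  \<open>n \<ge> 2\<close>, to the diagonal by dominated convergence (\<open>green_identity\<close>).\<close>

section \<open>Bounded Borel functions\<close>

lemma bounded_borel_set_integrable:
  fixes f :: "real \<Rightarrow> real"
  assumes "f \<in> borel_measurable borel" and "\<And>x. \<bar>f x\<bar> \<le> C"
  shows "set_integrable lborel {u..v} f"
  unfolding set_integrable_def
proof (rule Bochner_Integration.integrable_bound)
  show "integrable lborel (\<lambda>x. indicator {u..v} x *\<^sub>R C)"
    by (intro integrable_scaleR_left) (simp add: integrable_indicator_iff emeasure_lborel_Icc_eq)
  show "(\<lambda>x. indicat_real {u..v} x *\<^sub>R f x) \<in> borel_measurable lborel"
    using assms(1) by simp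
  have "\<bar>f x\<bar> \<le> \<bar>C\<bar>" for x
    using assms(2)[of x] by linarith
  then show "AE x in lborel. norm (indicat_real {u..v} x *\<^sub>R f x) \<le> norm (indicat_real {u..v} x *\<^sub>R C)"
    by (auto simp: indicator_def)
qed

lemma bounded_borel_integrable_on:
  fixes f :: "real \<Rightarrow> real"
  assumes "f \<in> borel_measurable borel" and "\<And>x. \<bar>f x\<bar> \<le> C"
  shows "f integrable_on {u..v}"
  using set_borel_integral_eq_integral(1)[OF bounded_borel_set_integrable[OF assms]] .

text \<open>The integrals are gauge integrals, for which a Fubini theorem with merely measurable integrands is
  reached through the Lebesgue integral; boundedness on a rectangle supplies the integrability.\<close>

lemma bounded_borel_Fubini:
  fixes F :: "real \<Rightarrow> real \<Rightarrow> real"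
  assumes meas: "(\<lambda>(x, r). F x r) \<in> borel_measurable borel" and bd: "\<And>x r. \<bar>F x r\<bar> \<le> C"
  shows "((\<lambda>x. integral {p..q} (\<lambda>r. F x r)) has_integral
      integral {p..q} (\<lambda>r. integral {u..v} (\<lambda>x. F x r))) {u..v}"
proof -
  have m2 [measurable]: "(\<lambda>z. F (fst z) (snd z)) \<in> borel_measurable (borel \<Otimes>\<^sub>M borel)"
    using meas by (simp add: borel_prod case_prod_unfold)
  have mx [measurable]: "(\<lambda>r. F x r) \<in> borel_measurable borel" for x
    by (rule measurable_compose[OF _ m2, of "\<lambda>r. (x, r)", simplified]) simp
  have mr [measurable]: "(\<lambda>x. F x r) \<in> borel_measurable borel" for r
    by (rule measurable_compose[OF _ m2, of "\<lambda>x. (x, r)", simplified]) simp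
  define G where "G x r = indicator {u..v} x *\<^sub>R (indicator {p..q} r *\<^sub>R F x r)" for x r
  have Gint: "integrable (lborel \<Otimes>\<^sub>M lborel) (\<lambda>(x, r). G x r)"
  proof (rule Bochner_Integration.integrable_bound)
    show "integrable (lborel \<Otimes>\<^sub>M lborel) (\<lambda>z. indicator ({u..v} \<times> {p..q}) z *\<^sub>R C)"
      by (intro integrable_scaleR_left)
         (simp add: integrable_indicator_iff lborel.emeasure_pair_measure_Times
           emeasure_lborel_Icc_eq ennreal_mult_less_top)
    show "(\<lambda>(x, r). G x r) \<in> borel_measurable (lborel \<Otimes>\<^sub>M lborel)"
      unfolding G_def split_beta by measurable
    have "\<bar>F x r\<bar> \<le> \<bar>C\<bar>" for x r
      using bd[of x r] by linarith
    then show "AE z in lborel \<Otimes>\<^sub>M lborel. norm (case z of (x, r) \<Rightarrow> G x r)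
        \<le> norm (indicat_real ({u..v} \<times> {p..q}) z *\<^sub>R C)"
      by (auto simp: G_def indicator_def)
  qed
  have i1: "(\<integral>r. G x r \<partial>lborel) = indicator {u..v} x *\<^sub>R integral {p..q} (\<lambda>r. F x r)" for x
    unfolding G_def
    using set_borel_integral_eq_integral(2)[OF bounded_borel_set_integrable[OF mx bd], of p q x]
    by (simp add: set_lebesgue_integral_def)
  have i2: "(\<integral>x. G x r \<partial>lborel) = indicator {p..q} r *\<^sub>R integral {u..v} (\<lambda>x. F x r)" for r
    unfolding G_def
    using set_borel_integral_eq_integral(2)[OF bounded_borel_set_integrable[OF mr bd], of u v r]
    by (simp add: set_lebesgue_integral_def mult.left_commute)
  have s1: "set_integrable lborel {u..v} (\<lambda>x. integral {p..q} (\<lambda>r. F x r))"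
    using lborel_pair.integrable_fst[OF Gint] by (simp add: i1 set_integrable_def)
  have s2: "set_integrable lborel {p..q} (\<lambda>r. integral {u..v} (\<lambda>x. F x r))"
    using lborel_pair.integrable_snd[OF Gint] by (simp add: i2 set_integrable_def)
  have "(\<integral>r. (\<integral>x. G x r \<partial>lborel) \<partial>lborel) = (\<integral>x. (\<integral>r. G x r \<partial>lborel) \<partial>lborel)"
    by (rule lborel_pair.Fubini_integral[OF Gint])
  then have "integral {u..v} (\<lambda>x. integral {p..q} (\<lambda>r. F x r))
      = integral {p..q} (\<lambda>r. integral {u..v} (\<lambda>x. F x r))"
    using set_borel_integral_eq_integral(2)[OF s1] set_borel_integral_eq_integral(2)[OF s2]
    by (simp add: i1 i2 set_lebesgue_integral_def)
  then show ?thesis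
    using set_borel_integral_eq_integral(1)[OF s1] by (simp add: has_integral_integral)
qed

section \<open>A Gronwall inequality across an exceptional point\<close>

lemma nonincreasing_except_point:
  fixes f :: "real \<Rightarrow> real"
  assumes uv: "u \<le> v" and cont: "continuous_on {u..v} f"
    and der: "\<And>x. x \<in> {u<..<v} - {s} \<Longrightarrow> \<exists>d. (f has_real_derivative d) (at x) \<and> d \<le> 0"
  shows "f v \<le> f u"
proof (cases "s \<in> {u<..<v}")
  case True
  have "f s \<le> f u"
    by (rule DERIV_nonpos_imp_decreasing_open)
       (use True der in \<open>auto intro!: continuous_on_subset[OF cont]\<close>)
  moreover have "f v \<le> f s"
    by (rule DERIV_nonpos_imp_decreasing_open)
       (use True der in \<open>auto intro!: continuous_on_subset[OF cont]\<close>)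
  ultimately show ?thesis by linarith
next
  case False
  then show ?thesis
    by (intro DERIV_nonpos_imp_decreasing_open[OF uv _ cont] der) auto
qed

text \<open>The bound holds in both directions, because \<open>\<bar>P'\<bar> \<le> K P\<close> makes \<open>P(x) e\<^sup>-\<^sup>K\<^sup>x\<close> nonincreasing and
  \<open>P(x) e\<^sup>K\<^sup>x\<close> nondecreasing.  The exceptional point is the one where the derivatives of a Green's
  function jump; continuity of \<open>P\<close> carries the monotonicity across it.\<close>

lemma gronwall_except_point:
  fixes P :: "real \<Rightarrow> real"
  assumes cont: "continuous_on {a..b} P" and pos: "\<And>x. x \<in> {a..b} \<Longrightarrow> 0 \<le> P x" and K: "0 \<le> K"
    and der: "\<And>x. x \<in> {a<..<b} - {s} \<Longrightarrow> \<exists>d. (P has_real_derivative d) (at x) \<and> \<bar>d\<bar> \<le> K * P x"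
    and xy: "x \<in> {a..b}" "y \<in> {a..b}"
  shows "P x \<le> exp (K * (b - a)) * P y"
proof -
  have "P v \<le> exp (K * (v - u)) * P u \<and> P u \<le> exp (K * (v - u)) * P v"
    if "u \<le> v" "u \<in> {a..b}" "v \<in> {a..b}" for u v
  proof -
    have sub: "{u..v} \<subseteq> {a..b}" using that by auto
    have "P v * exp (- K * (v - u)) \<le> P u * exp (- K * (u - u))"
    proof (rule nonincreasing_except_point[of u v _ s])
      show "continuous_on {u..v} (\<lambda>x. P x * exp (- K * (x - u)))"
        by (intro continuous_intros continuous_on_subset[OF cont] sub)
      fix x assume x: "x \<in> {u<..<v} - {s}"
      then have "x \<in> {a<..<b} - {s}"
        using that by auto
      then obtain d where d: "(P has_real_derivative d) (at x)" "\<bar>d\<bar> \<le> K * P x"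
        using der by blast
      have "((\<lambda>x. P x * exp (- K * (x - u))) has_real_derivative
          (d - K * P x) * exp (- K * (x - u))) (at x)"
        by (auto intro!: derivative_eq_intros d simp: algebra_simps)
      moreover have "(d - K * P x) * exp (- K * (x - u)) \<le> 0"
        using d by (intro mult_nonpos_nonneg) auto
      ultimately show "\<exists>d. ((\<lambda>x. P x * exp (- K * (x - u))) has_real_derivative d) (at x) \<and> d \<le> 0"
        by blast
    qed (fact that)
    moreover have "- (P v * exp (K * (v - u))) \<le> - (P u * exp (K * (u - u)))"
    proof (rule nonincreasing_except_point[of u v _ s])
      show "continuous_on {u..v} (\<lambda>x. - (P x * exp (K * (x - u))))"
        by (intro continuous_intros continuous_on_subset[OF cont] sub)
      fix x assume x: "x \<in> {u<..<v} - {s}"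
      then have "x \<in> {a<..<b} - {s}"
        using that by auto
      then obtain d where d: "(P has_real_derivative d) (at x)" "\<bar>d\<bar> \<le> K * P x"
        using der by blast
      have "((\<lambda>x. - (P x * exp (K * (x - u)))) has_real_derivative
          - ((d + K * P x) * exp (K * (x - u)))) (at x)"
        by (auto intro!: derivative_eq_intros d simp: algebra_simps)
      moreover have "- ((d + K * P x) * exp (K * (x - u))) \<le> 0"
        using d by (simp add: abs_le_iff)
      ultimately show "\<exists>d. ((\<lambda>x. - (P x * exp (K * (x - u)))) has_real_derivative d) (at x) \<and> d \<le> 0"
        by blast
    qed (fact that)
    moreover have "exp (- K * (v - u)) = inverse (exp (K * (v - u)))"
      by (simp flip: exp_minus)
    ultimately show ?thesis
      by (simp add: pos_divide_le_eq mult.commute flip: divide_inverse)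
  qed
  note pw = this
  have mono: "exp (K * w) * P z \<le> exp (K * (b - a)) * P z" if "z \<in> {a..b}" "w \<le> b - a" for w z
    using that pos K by (intro mult_right_mono) (auto intro: mult_left_mono)
  show ?thesis
  proof (cases "x \<le> y")
    case True
    then show ?thesis
      using pw[of x y] mono[of y "y - x"] xy by auto
  next
    case False
    then show ?thesis
      using pw[of y x] mono[of y "x - y"] xy by auto
  qed
qed

section \<open>The equation as a first order system\<close>

text \<open>The equation \<open>T\<^sub>n\<^sub>,\<^sub>k[M] u = 0\<close> solved for \<open>u\<^sup>(\<^sup>n\<^sup>)\<close>, as a function of the list
  \<open>Y = (u, u', \<dots>, u\<^sup>(\<^sup>n\<^sup>-\<^sup>1\<^sup>))\<close> of lower derivatives.\<close>

definition ode_rhs :: "nat \<Rightarrow> (nat \<Rightarrow> real \<Rightarrow> real) \<Rightarrow> nat \<Rightarrow> real \<Rightarrow> real \<Rightarrow> (nat \<Rightarrow> real) \<Rightarrow> real" where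
  "ode_rhs n c k M t Y = - (\<Sum>i=1..n. c i t * Y (n - i)) - M * Y k"

lemma T_op_eq_0_iff:
  "T_op a b n c k M u t = 0 \<longleftrightarrow>
    nderiv {a..b} n u t = ode_rhs n c k M t (\<lambda>j. nderiv {a..b} j u t)"
  by (auto simp: T_op_def L_op_def ode_rhs_def)

lemma ode_rhs_cong:
  assumes "k < n" and "\<And>j. j < n \<Longrightarrow> Y j = Z j"
  shows "ode_rhs n c k M t Y = ode_rhs n c k M t Z"
  unfolding ode_rhs_def using assms by (intro arg_cong2[of _ _ _ _ "(-)"] arg_cong[of _ _ uminus] sum.cong) auto

text \<open>Identifying the iterated derivatives of \<open>W 0\<close> amounts to exhibiting a chain of functions in which each
  is the derivative of its predecessor.\<close>

lemma nderiv_eqI: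
  assumes ab: "a < b"
    and der: "\<And>j t. j < m \<Longrightarrow> t \<in> {a..b} \<Longrightarrow> (W j has_vector_derivative W (Suc j) t) (at t within {a..b})"
    and j: "j \<le> m" and t: "t \<in> {a..b}"
  shows "nderiv {a..b} j (W 0) t = W j t"
  using j t
proof (induction j arbitrary: t)
  case (Suc j)
  have "(nderiv {a..b} j (W 0) has_vector_derivative W (Suc j) t) (at t within {a..b})"
    by (rule has_vector_derivative_transform[OF Suc.prems(2) _ der]) (use Suc in auto)
  then show ?case
    using vector_derivative_within_closed_interval[OF ab Suc.prems(2)] by simp
qed simp

lemma Cn_onI:
  assumes ab: "a < b"
    and der: "\<And>j t. j < m \<Longrightarrow> t \<in> {a..b} \<Longrightarrow> (W j has_vector_derivative W (Suc j) t) (at t within {a..b})"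
    and cont: "continuous_on {a..b} (W m)"
  shows "Cn_on m {a..b} (W 0)"
proof -
  have eq: "nderiv {a..b} j (W 0) t = W j t" if "j \<le> m" "t \<in> {a..b}" for j t
    by (rule nderiv_eqI[where W = W, OF ab der that])
  have "nderiv {a..b} j (W 0) differentiable (at t within {a..b})" if "j < m" "t \<in> {a..b}" for j t
  proof -
    have "(nderiv {a..b} j (W 0) has_vector_derivative W (Suc j) t) (at t within {a..b})"
      by (rule has_vector_derivative_transform[OF that(2) _ der]) (use that eq in auto)
    then show ?thesis
      by (rule differentiableI_vector)
  qed
  moreover have "continuous_on {a..b} (nderiv {a..b} j (W 0))" if "j \<le> m" for j
  proof -
    have "continuous_on {a..b} (W j)"
    proof (cases "j = m")
      case False
      then show ?thesis
        using that by (intro continuous_on_vector_derivative[of _ _ "W (Suc j)"] der) auto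
    qed (simp add: cont)
    then show ?thesis
      using eq that by (subst continuous_on_cong[OF refl]) auto
  qed
  ultimately show ?thesis
    by (auto simp: Cn_on_def)
qed

text \<open>The uniqueness hypothesis speaks of \<open>n\<close> times continuously differentiable functions, whereas the
  functions to which it will be applied are built from Green's functions, whose derivatives are
  unspecified or jump at \<open>t = s\<close>.  The integrated form of the equation does not notice a single point:
  replacing each component \<open>z j\<close> by its initial value plus the integral of the next one yields continuous
  functions, the integrand of the last one is then continuous too, and so the components become the
  successive derivatives of a genuine solution of the homogeneous problem.\<close>

lemma zero_of_homogeneous_integral_system:
  assumes ab: "a < b" and kn: "k < n"
    and c: "\<And>i. i \<in> {1..n} \<Longrightarrow> continuous_on {a..b} (c i)"
    and uniq: "bvp_uniquely_solvable a b n c \<alpha> \<beta> k M"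
    and s: "s \<in> {a<..<b}"
    and z: "\<And>j t. j < n \<Longrightarrow> t \<in> {a..b} - {s} \<Longrightarrow> (z (Suc j) has_integral z j t - z j a) {a..t}"
    and zn: "\<And>t. t \<in> {a..b} - {s} \<Longrightarrow> z n t = ode_rhs n c k M t (\<lambda>j. z j t)"
    and bc: "\<And>i. i \<in> {1..n} \<Longrightarrow> (\<Sum>j<n. \<alpha> i j * z j a + \<beta> i j * z j b) = 0"
    and t: "t \<in> {a..b} - {s}"
  shows "z 0 t = 0"
proof -
  define Z where "Z j x = z j a + integral {a..x} (z (Suc j))" for j x
  \<comment> \<open>The continuous modifications of the components, with the \<open>n\<close>-th one forced by the equation.\<close>
  define W where "W j x = (if j < n then Z j x else ode_rhs n c k M x (\<lambda>i. Z i x))" for j x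
  have Z_eq: "Z j x = z j x" if "j < n" "x \<in> {a..b} - {s}" for j x
    using integral_unique[OF z[OF that]] by (simp add: Z_def)
  have W_eq: "W j x = z j x" if "j \<le> n" "x \<in> {a..b} - {s}" for j x
  proof (cases "j < n")
    case False
    then have "j = n" using that by simp
    then show ?thesis
      using zn[OF that(2)] ode_rhs_cong[OF kn, of "\<lambda>i. Z i x" "\<lambda>i. z i x" c M x] Z_eq that
      by (simp add: W_def)
  qed (use Z_eq that in \<open>simp add: W_def\<close>)
  have Z_cont: "continuous_on {a..b} (Z j)" if "j < n" for j
  proof -
    have "z (Suc j) integrable_on {a..b}"
      using z[OF that, of b] s ab by auto
    then show ?thesis
      unfolding Z_def by (intro continuous_intros indefinite_integral_continuous_1)
  qed
  have W_cont: "continuous_on {a..b} (W j)" if "j \<le> n" for j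
  proof (cases "j < n")
    case True
    then show ?thesis
      using Z_cont[OF True] by (simp add: W_def[abs_def])
  next
    case False
    have "continuous_on {a..b} (\<lambda>x. ode_rhs n c k M x (\<lambda>i. Z i x))"
      unfolding ode_rhs_def using kn by (intro continuous_intros c Z_cont) auto
    then show ?thesis
      using False by (simp add: W_def[abs_def])
  qed
  have der: "(W j has_vector_derivative W (Suc j) x) (at x within {a..b})"
    if j: "j < n" and x: "x \<in> {a..b}" for j x
  proof (rule has_vector_derivative_transform[OF x])
    have "((\<lambda>u. integral {a..u} (W (Suc j))) has_vector_derivative W (Suc j) x) (at x within {a..b})"
      using W_cont[of "Suc j"] j x by (intro integral_has_vector_derivative) auto
    then show "((\<lambda>u. z j a + integral {a..u} (W (Suc j))) has_vector_derivative W (Suc j) x)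
        (at x within {a..b})"
      by (auto intro!: derivative_eq_intros)
    fix y assume y: "y \<in> {a..b}"
    have "integral {a..y} (W (Suc j)) = integral {a..y} (z (Suc j))"
      by (rule integral_spike[of "{s}"]) (use y j W_eq[of "Suc j"] in auto)
    then show "W j y = z j a + integral {a..y} (W (Suc j))"
      using j by (simp add: W_def Z_def)
  qed
  have nd: "nderiv {a..b} j (W 0) x = W j x" if "j \<le> n" "x \<in> {a..b}" for j x
    using nderiv_eqI[where W = W, OF ab der that] by blast
  have a: "a \<in> {a..b} - {s}" and b: "b \<in> {a..b} - {s}"
    using s ab by auto
  have sol: "bvp_solution a b n c \<alpha> \<beta> k M (\<lambda>_. 0) (W 0)"
    unfolding bvp_solution_def T_op_eq_0_iff
  proof (intro conjI ballI)
    show "Cn_on n {a..b} (W 0)"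
      by (rule Cn_onI[where W = W, OF ab der W_cont]) auto
    show "nderiv {a..b} n (W 0) x = ode_rhs n c k M x (\<lambda>j. nderiv {a..b} j (W 0) x)"
      if "x \<in> {a..b}" for x
      using that nd[of _ x] ode_rhs_cong[OF kn, of "\<lambda>i. nderiv {a..b} i (W 0) x" "\<lambda>i. Z i x" c M x]
      by (simp add: W_def)
    show "B_form a b n \<alpha> \<beta> i (W 0) = 0" if "i \<in> {1..n}" for i
      using bc[OF that] ab nd W_eq a b by (simp add: B_form_def)
  qed
  have sol0: "bvp_solution a b n c \<alpha> \<beta> k M (\<lambda>_. 0) (\<lambda>_. 0)"
  proof -
    have nd0: "nderiv {a..b} j (\<lambda>_. 0) x = 0" if "x \<in> {a..b}" for j x
      using nderiv_eqI[where W = "\<lambda>_ _. 0" and m = j, OF ab] that by simp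
    have "Cn_on n {a..b} (\<lambda>_. 0)"
      using Cn_onI[where W = "\<lambda>_ _. 0" and m = n, OF ab] by simp
    then show ?thesis
      using ab kn by (simp add: bvp_solution_def nd0 T_op_def L_op_def B_form_def)
  qed
  have "W 0 t = 0"
    using uniq sol sol0 t unfolding bvp_uniquely_solvable_def
    by (metis DiffD1 continuous_on_const)
  then show ?thesis
    using W_eq[of 0 t] t by simp
qed

section \<open>Regularity and uniform bounds of a Green's function\<close>

text \<open>Continuous coefficients are bounded on the compact interval, so the right-hand side grows at most
  linearly, uniformly in \<open>t\<close>.  This is the source of the Gronwall constant.\<close>

lemma ode_rhs_bound:
  assumes kn: "k < n" and c: "\<And>i. i \<in> {1..n} \<Longrightarrow> continuous_on {a..b} (c i)"
  obtains Q where "0 \<le> Q" and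
    "\<And>t Y B. t \<in> {a..b} \<Longrightarrow> (\<And>j. j < n \<Longrightarrow> \<bar>Y j\<bar> \<le> B) \<Longrightarrow> \<bar>ode_rhs n c k M t Y\<bar> \<le> Q * B"
proof -
  have "\<exists>A. \<forall>t\<in>{a..b}. \<bar>c i t\<bar> \<le> A" if "i \<in> {1..n}" for i
  proof -
    have "bounded (c i ` {a..b})"
      using c[OF that] by (intro compact_imp_bounded compact_continuous_image) auto
    then show ?thesis
      by (auto simp: bounded_iff)
  qed
  then obtain A where A: "\<And>i t. i \<in> {1..n} \<Longrightarrow> t \<in> {a..b} \<Longrightarrow> \<bar>c i t\<bar> \<le> A i"
    by metis
  show thesis
  proof
    show "0 \<le> (\<Sum>i=1..n. \<bar>A i\<bar>) + \<bar>M\<bar>"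
      by (simp add: sum_nonneg)
    fix t Y and B :: real
    assume t: "t \<in> {a..b}" and Y: "\<And>j. j < n \<Longrightarrow> \<bar>Y j\<bar> \<le> B"
    have B0: "0 \<le> B"
      using Y[OF kn] by linarith
    have "\<bar>\<Sum>i=1..n. c i t * Y (n - i)\<bar> \<le> (\<Sum>i=1..n. \<bar>A i\<bar> * B)"
    proof (rule order_trans[OF sum_abs], rule sum_mono)
      fix i assume i: "i \<in> {1..n}"
      have "\<bar>c i t\<bar> \<le> \<bar>A i\<bar>" "\<bar>Y (n - i)\<bar> \<le> B"
        using A[OF i t] Y[of "n - i"] i by auto
      then show "\<bar>c i t * Y (n - i)\<bar> \<le> \<bar>A i\<bar> * B"
        unfolding abs_mult by (intro mult_mono) auto
    qed
    moreover have "\<bar>M * Y k\<bar> \<le> \<bar>M\<bar> * B"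
      unfolding abs_mult using Y[OF kn] by (intro mult_left_mono) auto
    ultimately show "\<bar>ode_rhs n c k M t Y\<bar> \<le> ((\<Sum>i=1..n. \<bar>A i\<bar>) + \<bar>M\<bar>) * B"
      by (simp add: ode_rhs_def sum_distrib_right[symmetric] distrib_right)
  qed
qed

text \<open>The parameter \<open>s\<close> ranges over the open interval, since the differential equation, the boundary
  conditions and the jump are only prescribed there.\<close>

definition off_diag :: "real \<Rightarrow> real \<Rightarrow> (real \<times> real) set" where
  "off_diag a b = {(t, s). t \<in> {a..b} \<and> s \<in> {a<..<b} \<and> t \<noteq> s}"

lemma off_diag_borel: "off_diag a b \<in> sets borel"
proof -
  have "open {z :: real \<times> real. fst z \<noteq> snd z}"
    by (intro open_Collect_neq continuous_intros)
  moreover have "off_diag a b = ({a..b} \<times> UNIV) \<inter> ((UNIV \<times> {a<..<b}) \<inter> {z. fst z \<noteq> snd z})"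
    by (auto simp: off_diag_def)
  moreover have "closed ({a..b} \<times> (UNIV :: real set))" "open ((UNIV :: real set) \<times> {a<..<b})"
    by (auto intro!: closed_Times open_Times)
  ultimately show ?thesis
    by (simp only:) (intro sets.Int borel_closed borel_open open_Int; assumption)
qed

text \<open>The \<open>j\<close>-th derivative of a Green's function, extended by zero to the whole plane so that it becomes a
  Borel function of two real variables.  On the diagonal the derivatives of order \<open>n - 1\<close> and \<open>n\<close> carry no
  information, and the value chosen there does not affect integrals.\<close>

definition green_ker :: "real \<Rightarrow> real \<Rightarrow> nat \<Rightarrow> (real \<Rightarrow> real \<Rightarrow> real) \<Rightarrow> real \<Rightarrow> real \<Rightarrow> real" where
  "green_ker a b j g t s = (if (t, s) \<in> off_diag a b then dt a b j g t s else 0)"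

locale green_function =
  fixes a b :: real and n k :: nat and M :: real
    and c :: "nat \<Rightarrow> real \<Rightarrow> real" and \<alpha> \<beta> :: "nat \<Rightarrow> nat \<Rightarrow> real" and g :: "real \<Rightarrow> real \<Rightarrow> real"
  assumes ab: "a < b" and kn: "k < n"
    and coeff: "\<And>i. i \<in> {1..n} \<Longrightarrow> continuous_on {a..b} (c i)"
    and green: "is_green a b n c \<alpha> \<beta> k M g"
begin

abbreviation D :: "nat \<Rightarrow> real \<Rightarrow> real \<Rightarrow> real" where
  "D j t s \<equiv> dt a b j g t s"

abbreviation K :: "nat \<Rightarrow> real \<Rightarrow> real \<Rightarrow> real" where
  "K j t s \<equiv> green_ker a b j g t s"

lemma D_continuous_off_diagonal:
  assumes "j \<le> n"
  shows "continuous_on ({a..b} \<times> {a..b} - {(t, t) |t. t \<in> {a..b}}) (\<lambda>(t, s). D j t s)"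
  using green assms unfolding is_green_def Ct_on_def by blast

lemma D_continuous_on_square:
  assumes "2 \<le> n" "j \<le> n - 2"
  shows "continuous_on ({a..b} \<times> {a..b}) (\<lambda>(t, s). D j t s)"
  using green assms unfolding is_green_def Ct_on_def by blast

text \<open>Continuity in the second variable: off the diagonal in every order, and on the diagonal in the orders up
  to \<open>n - 2\<close>.  It will extend the identities from generic \<open>(t, s)\<close> to the endpoints and the diagonal.\<close>

lemma D_tendsto:
  assumes j: "j \<le> n" and t: "t \<in> {a..b}" and s: "s \<in> {a..b}"
    and reg: "t \<noteq> s \<or> Suc j < n"
    and S: "\<And>m. S m \<in> {a..b} - {t}" "S \<longlonglongrightarrow> s"
  shows "(\<lambda>m. D j t (S m)) \<longlonglongrightarrow> D j t s"
proof -
  define A where "A = (if t \<noteq> s then {a..b} \<times> {a..b} - {(t, t) |t. t \<in> {a..b}} else {a..b} \<times> {a..b})"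
  have cont: "continuous_on A (\<lambda>(t, s). D j t s)"
    using D_continuous_off_diagonal[OF j] D_continuous_on_square[of j] reg by (auto simp: A_def)
  have lim: "(\<lambda>m. (t, S m)) \<longlonglongrightarrow> (t, s)"
    by (intro tendsto_intros S)
  have "(t, s) \<in> A" "(t, S m) \<in> A" for m
    using S(1)[of m] t s by (auto simp: A_def)
  then show ?thesis
    using continuous_on_tendsto_compose[OF cont lim] by simp
qed

lemma D_has_derivative:
  assumes "j < n" and s: "s \<in> {a..b}" and t: "t \<in> {a..b} - {s}"
  shows "((\<lambda>x. D j x s) has_vector_derivative D (Suc j) t s) (at t within {a..b})"
proof -
  have "Ct_on a b n ({a..b} \<times> {a..b} - {(t, t) |t. t \<in> {a..b}}) g"
    using green by (simp only: is_green_def)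
  moreover have "(t, s) \<in> {a..b} \<times> {a..b} - {(t, t) |t. t \<in> {a..b}}"
    using s t by auto
  ultimately have "(\<lambda>r. D j r s) differentiable (at t within {a..b})"
    using \<open>j < n\<close> unfolding Ct_on_def by blast
  then show ?thesis
    unfolding vector_derivative_works by (simp add: dt_def[abs_def])
qed

lemma D_ode:
  assumes s: "s \<in> {a<..<b}" and t: "t \<in> {a..b} - {s}"
  shows "D n t s = ode_rhs n c k M t (\<lambda>j. D j t s)"
proof -
  have "T_op a b n c k M (\<lambda>r. g r s) t = 0"
    using green assms unfolding is_green_def by blast
  then show ?thesis
    by (simp add: T_op_eq_0_iff dt_def)
qed

lemma D_boundary:
  assumes s: "s \<in> {a<..<b}" and i: "i \<in> {1..n}"
  shows "(\<Sum>j<n. \<alpha> i j * D j a s + \<beta> i j * D j b s) = 0"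
proof -
  have "B_form a b n \<alpha> \<beta> i (\<lambda>r. g r s) = 0"
    using green assms unfolding is_green_def by blast
  then show ?thesis
    by (simp add: B_form_def dt_def)
qed

text \<open>The discontinuity of the \<open>j\<close>-th derivative across \<open>t = s\<close>: a unit step in order \<open>n - 1\<close>, none in lower
  orders.\<close>

definition jump :: "nat \<Rightarrow> real \<Rightarrow> real \<Rightarrow> real" where
  "jump j t s = (if Suc j = n \<and> s < t then 1 else 0)"

text \<open>In order \<open>n - 1\<close> the lateral limits at \<open>s\<close> differ by exactly the height of the step, so subtracting the
  step leaves a removable discontinuity.\<close>

lemma D_minus_jump_extends:
  assumes j: "j < n" and s: "s \<in> {a<..<b}"
  shows "\<exists>y. continuous_on {a..b} y \<and> (\<forall>x\<in>{a..b} - {s}. y x = D j x s - jump j x s)"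
proof (cases "Suc j = n")
  case False
  then have "continuous_on ({a..b} \<times> {a..b}) (\<lambda>(t, s). D j t s)"
    using j by (intro D_continuous_on_square) auto
  then have "continuous_on {a..b} (\<lambda>x. (\<lambda>(t, s). D j t s) (x, s))"
    by (rule continuous_on_compose2) (use s in \<open>auto intro!: continuous_intros\<close>)
  then show ?thesis
    using False by (intro exI[of _ "\<lambda>x. D j x s"]) (auto simp: jump_def)
next
  case True
  then obtain l l' where l: "((\<lambda>r. D j r s) \<longlongrightarrow> l) (at_left s)"
    and l': "((\<lambda>r. D j r s) \<longlongrightarrow> l') (at_right s)" and ll: "l' - l = 1"
    using green s unfolding is_green_def by (metis diff_Suc_1)
  define y where "y x = (if x = s then l else D j x s - jump j x s)" for x
  have "continuous (at x within {a..b}) y" if x: "x \<in> {a..b}" for x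
  proof (cases "x = s")
    case False
    have "continuous (at x within {a..b}) (\<lambda>x. D j x s)"
      by (rule has_vector_derivative_continuous[OF D_has_derivative]) (use j s x False in auto)
    then have "continuous (at x within {a..b}) (\<lambda>z. D j z s - jump j x s)"
      by (intro continuous_intros)
    then show ?thesis
      by (rule continuous_transform_within[of _ _ _ "\<bar>x - s\<bar>"])
         (use x False in \<open>auto simp: y_def jump_def dist_real_def\<close>)
  next
    case True
    have "(y \<longlongrightarrow> l) (at_left s)"
      by (rule Lim_transform_eventually[OF l])
         (auto simp: eventually_at_filter y_def jump_def)
    moreover have "(y \<longlongrightarrow> l' - 1) (at_right s)"
      by (rule Lim_transform_eventually[OF tendsto_diff[OF l' tendsto_const[of 1]]])
         (use \<open>Suc j = n\<close> in \<open>auto simp: eventually_at_filter y_def jump_def\<close>)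
    moreover have "l' - 1 = l"
      using ll by simp
    ultimately have "(y \<longlongrightarrow> l) (at s)"
      by (simp add: filterlim_split_at)
    then have "isCont y s"
      by (simp add: isCont_def y_def)
    then show ?thesis
      using True by (simp add: continuous_at_imp_continuous_at_within)
  qed
  then show ?thesis
    unfolding continuous_on_eq_continuous_within by (intro exI[of _ y]) (auto simp: y_def)
qed

lemma D_minus_jump_derivative:
  assumes j: "j < n" and s: "s \<in> {a<..<b}" and x: "x \<in> {a<..<b} - {s}"
    and y: "\<And>z. z \<in> {a..b} - {s} \<Longrightarrow> y z = D j z s - jump j z s"
  shows "(y has_vector_derivative D (Suc j) x s) (at x)"
proof -
  have "((\<lambda>x. D j x s) has_vector_derivative D (Suc j) x s) (at x within {a..b})"
    using x s by (intro D_has_derivative j) auto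
  then have "((\<lambda>x. D j x s) has_vector_derivative D (Suc j) x s) (at x)"
    using x by (simp add: at_within_Icc_at)
  then have d: "((\<lambda>z. D j z s - jump j x s) has_vector_derivative D (Suc j) x s) (at x)"
    by (auto intro!: derivative_eq_intros)
  show ?thesis
  proof (rule has_vector_derivative_transform_within_open[OF d])
    show "open (if x < s then {a<..<s} else {s<..<b})" by simp
    show "x \<in> (if x < s then {a<..<s} else {s<..<b})" using x by auto
    fix z assume "z \<in> (if x < s then {a<..<s} else {s<..<b})"
    then show "D j z s - jump j x s = y z"
      using y[of z] s x by (auto simp: jump_def split: if_splits)
  qed
qed

text \<open>This packages the differential structure and the jump condition in one integral formula, by the
  fundamental theorem of calculus for the continuous function obtained by removing the step.\<close>

lemma D_increment:
  assumes j: "j < n" and s: "s \<in> {a<..<b}" and t: "t \<in> {a..b} - {s}"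
  shows "((\<lambda>x. D (Suc j) x s) has_integral D j t s - D j a s - jump j t s) {a..t}"
proof -
  obtain y where y: "continuous_on {a..b} y" "\<And>x. x \<in> {a..b} - {s} \<Longrightarrow> y x = D j x s - jump j x s"
    using D_minus_jump_extends[OF j s] by auto
  have "((\<lambda>x. D (Suc j) x s) has_integral y t - y a) {a..t}"
  proof (rule fundamental_theorem_of_calculus_interior_strong[of "{s}"])
    show "continuous_on {a..t} y"
      using t by (intro continuous_on_subset[OF y(1)]) auto
    show "(y has_vector_derivative D (Suc j) x s) (at x)" if "x \<in> {a<..<t} - {s}" for x
      using that t by (intro D_minus_jump_derivative[OF j s _ y(2)]) auto
  qed (use t in auto)
  moreover have "y t - y a = D j t s - D j a s - jump j t s"
    using y(2)[of t] y(2)[of a] t s by (auto simp: jump_def)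
  ultimately show ?thesis by simp
qed

text \<open>The definition of a Green's function gives only separate lateral limits at the diagonal, which do not
  bound the derivative of order \<open>n - 1\<close> nearby.  A bound comes from the equation instead: with the step
  removed, \<open>P = 1 + \<Sum> y\<^sub>i\<^sup>2\<close> satisfies \<open>\<bar>P'\<bar> \<le> q P\<close> with \<open>q\<close> independent of \<open>s\<close>, and so the
  values at one point \<open>e\<close> control all others, on either side of \<open>s\<close>.  The summand \<open>1\<close> in \<open>P\<close> absorbs the
  step that reappears on the right-hand side of the equation.\<close>

lemma D_propagation_bound:
  obtains L where "0 \<le> L" and
    "\<And>s e t j B. s \<in> {a<..<b} \<Longrightarrow> e \<in> {a..b} - {s} \<Longrightarrow> (\<And>i. i < n \<Longrightarrow> \<bar>D i e s\<bar> \<le> B) \<Longrightarrow>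
      t \<in> {a..b} - {s} \<Longrightarrow> j < n \<Longrightarrow> \<bar>D j t s\<bar> \<le> L * (1 + real n * (B + 1)\<^sup>2) + 1"
proof -
  obtain Q where Q: "0 \<le> Q" "\<And>t Y B. t \<in> {a..b} \<Longrightarrow> (\<And>j. j < n \<Longrightarrow> \<bar>Y j\<bar> \<le> B) \<Longrightarrow>
      \<bar>ode_rhs n c k M t Y\<bar> \<le> Q * B"
    by (metis kn coeff ode_rhs_bound)
  \<comment> \<open>Each of the \<open>n\<close> terms \<open>2 y\<^sub>i y\<^sub>i'\<close> of \<open>P'\<close> is at most \<open>2 (2 (Q + 1)) P\<close>, since \<open>\<bar>y\<^sub>i\<bar> \<le> sqrt P\<close> and every
    derivative up to order \<open>n\<close> is at most \<open>2 (Q + 1) sqrt P\<close>.\<close>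
  define q where "q = 2 * real n * (2 * (Q + 1))"
  have q: "0 \<le> q" using Q by (simp add: q_def)
  show thesis
  proof
    show "0 \<le> exp (q * (b - a))" by simp
    fix s e t j and B :: real
    assume s: "s \<in> {a<..<b}" and e: "e \<in> {a..b} - {s}" and B: "\<And>i. i < n \<Longrightarrow> \<bar>D i e s\<bar> \<le> B"
      and t: "t \<in> {a..b} - {s}" and j: "j < n"
    obtain y where y: "\<And>i. i < n \<Longrightarrow> continuous_on {a..b} (y i)"
      "\<And>i x. i < n \<Longrightarrow> x \<in> {a..b} - {s} \<Longrightarrow> y i x = D i x s - jump i x s"
      using D_minus_jump_extends[OF _ s] by metis
    have Dy: "\<bar>D i x s\<bar> \<le> \<bar>y i x\<bar> + 1" "\<bar>y i x\<bar> \<le> \<bar>D i x s\<bar> + 1"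
      if "i < n" "x \<in> {a..b} - {s}" for i x
      using y(2)[OF that] by (auto simp: jump_def)
    define P where "P x = 1 + (\<Sum>i<n. (y i x)\<^sup>2)" for x
    have P1: "1 \<le> P x" for x
      by (simp add: P_def sum_nonneg)
    have yP: "(y i x)\<^sup>2 \<le> P x" if "i < n" for i x
      using member_le_sum[of i "{..<n}" "\<lambda>i. (y i x)\<^sup>2"] that by (simp add: P_def)
    have "P t \<le> exp (q * (b - a)) * P e"
    proof (rule gronwall_except_point[of a b P q s t e])
      show "continuous_on {a..b} P"
        unfolding P_def[abs_def] by (intro continuous_intros y) auto
      show "0 \<le> P x" for x using P1[of x] by simp
      fix x assume x: "x \<in> {a<..<b} - {s}"
      have ders: "(y i has_real_derivative D (Suc i) x s) (at x)" if "i < n" for i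
        unfolding has_real_derivative_iff_has_vector_derivative
        by (rule D_minus_jump_derivative[OF that s x y(2)[OF that]])
      have ysq: "\<bar>y i x\<bar> \<le> sqrt (P x)" if "i < n" for i
        using yP[OF that, of x] by (simp add: real_le_rsqrt)
      have sq1: "1 \<le> sqrt (P x)" using P1[of x] by simp
      have Dsq: "\<bar>D i x s\<bar> \<le> 2 * sqrt (P x)" if "i < n" for i
      proof -
        have "\<bar>D i x s\<bar> \<le> \<bar>y i x\<bar> + 1"
          using Dy(1)[OF that] x by simp
        then show ?thesis
          using ysq[OF that] sq1 by linarith
      qed
      have Dsq': "\<bar>D (Suc i) x s\<bar> \<le> 2 * (Q + 1) * sqrt (P x)" if "i < n" for i
      proof (cases "Suc i < n")
        case True
        have "0 \<le> Q * sqrt (P x)" using Q(1) sq1 by simp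
        then show ?thesis
          using Dsq[OF True] by (simp add: algebra_simps)
      next
        case False
        then have i: "Suc i = n" using that by simp
        have "\<bar>D n x s\<bar> \<le> Q * (2 * sqrt (P x))"
          using D_ode[OF s, of x] Q(2)[of x "\<lambda>i. D i x s"] Dsq x by auto
        then show ?thesis
          unfolding i using order_trans[OF zero_le_one sq1] by (simp add: algebra_simps del: real_sqrt_ge_0_iff)
      qed
      have "(P has_real_derivative (\<Sum>i<n. 2 * y i x * D (Suc i) x s)) (at x)"
        unfolding P_def[abs_def]
        by (auto intro!: derivative_eq_intros ders sum.cong)
      moreover have "\<bar>\<Sum>i<n. 2 * y i x * D (Suc i) x s\<bar> \<le> q * P x"
      proof -
        have "\<bar>2 * y i x * D (Suc i) x s\<bar> \<le> 2 * (2 * (Q + 1)) * P x" if "i < n" for i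
        proof -
          have "\<bar>y i x\<bar> * \<bar>D (Suc i) x s\<bar> \<le> sqrt (P x) * (2 * (Q + 1) * sqrt (P x))"
            by (intro mult_mono ysq[OF that] Dsq'[OF that]) (use sq1 in auto)
          also have "\<dots> = 2 * (Q + 1) * (sqrt (P x) * sqrt (P x))"
            by (rule mult.left_commute)
          also have "sqrt (P x) * sqrt (P x) = P x"
            using P1[of x] by simp
          finally have "2 * (\<bar>y i x\<bar> * \<bar>D (Suc i) x s\<bar>) \<le> 2 * (2 * (Q + 1) * P x)"
            by simp
          then show ?thesis
            by (simp only: abs_mult abs_numeral mult.assoc)
        qed
        then have "\<bar>\<Sum>i<n. 2 * y i x * D (Suc i) x s\<bar> \<le> (\<Sum>i<n. 2 * (2 * (Q + 1)) * P x)"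
          by (intro order_trans[OF sum_abs] sum_mono) auto
        then show ?thesis
          by (simp add: q_def algebra_simps)
      qed
      ultimately show "\<exists>d. (P has_real_derivative d) (at x) \<and> \<bar>d\<bar> \<le> q * P x"
        by blast
    qed (use q t e in auto)
    also have "\<dots> \<le> exp (q * (b - a)) * (1 + real n * (B + 1)\<^sup>2)"
    proof (rule mult_left_mono)
      have "(y i e)\<^sup>2 \<le> (B + 1)\<^sup>2" if "i < n" for i
        using Dy(2)[OF that e] B[OF that] by (intro abs_le_square_iff[THEN iffD1]) auto
      then have "(\<Sum>i<n. (y i e)\<^sup>2) \<le> (\<Sum>i<n. (B + 1)\<^sup>2)"
        by (intro sum_mono) auto
      then show "P e \<le> 1 + real n * (B + 1)\<^sup>2"
        by (simp add: P_def)
    qed simp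
    finally have "P t \<le> exp (q * (b - a)) * (1 + real n * (B + 1)\<^sup>2)" .
    moreover have "\<bar>y j t\<bar> \<le> P t"
    proof -
      have "\<bar>y j t\<bar> \<le> sqrt (P t)"
        using yP[OF j, of t] by (simp add: real_le_rsqrt)
      also have "\<dots> \<le> P t"
        using P1[of t] by (simp add: real_le_lsqrt power2_eq_square)
      finally show ?thesis .
    qed
    ultimately show "\<bar>D j t s\<bar> \<le> exp (q * (b - a)) * (1 + real n * (B + 1)\<^sup>2) + 1"
      using Dy(1)[OF j t] by linarith
  qed
qed

lemma D_bounded_on_far_edge:
  assumes e: "e \<in> {a..b}" and uv: "{u..v} \<subseteq> {a..b}" "e \<notin> {u..v}"
  obtains B where "\<And>s j. s \<in> {u..v} \<Longrightarrow> j < n \<Longrightarrow> \<bar>D j e s\<bar> \<le> B"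
proof -
  have "\<exists>B. \<forall>s\<in>{u..v}. \<bar>D j e s\<bar> \<le> B" if "j < n" for j
  proof -
    have "continuous_on {u..v} (\<lambda>s. (\<lambda>(t, s). D j t s) (e, s))"
      by (rule continuous_on_compose2[OF D_continuous_off_diagonal[of j]])
         (use that e uv in \<open>auto intro!: continuous_intros\<close>)
    then have "bounded ((\<lambda>s. D j e s) ` {u..v})"
      by (intro compact_imp_bounded compact_continuous_image) auto
    then show ?thesis
      by (auto simp: bounded_iff)
  qed
  then obtain B where B: "\<And>j s. j < n \<Longrightarrow> s \<in> {u..v} \<Longrightarrow> \<bar>D j e s\<bar> \<le> B j"
    by metis
  have "\<bar>D j e s\<bar> \<le> (\<Sum>i<n. \<bar>B i\<bar>)" if "s \<in> {u..v}" "j < n" for s j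
    using B[OF that(2,1)] member_le_sum[of j "{..<n}" "\<lambda>i. \<bar>B i\<bar>"] that by auto
  then show thesis using that by blast
qed

text \<open>For \<open>s\<close> in the right half of the interval the edge \<open>t = a\<close> stays away from the diagonal, and for \<open>s\<close> in the
  left half the edge \<open>t = b\<close> does.  On that edge the derivatives are bounded by compactness, and the bound
  propagates to all \<open>t\<close>, uniformly as \<open>s\<close> approaches an endpoint.\<close>

lemma D_bounded:
  obtains C where "\<And>t s j. s \<in> {a<..<b} \<Longrightarrow> t \<in> {a..b} - {s} \<Longrightarrow> j \<le> n \<Longrightarrow> \<bar>D j t s\<bar> \<le> C"
proof -
  define m where "m = (a + b) / 2"
  have m: "a < m" "m < b" using ab by (auto simp: m_def)
  obtain Ba where Ba: "\<And>s j. s \<in> {m..b} \<Longrightarrow> j < n \<Longrightarrow> \<bar>D j a s\<bar> \<le> Ba"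
    by (rule D_bounded_on_far_edge[of a m b]) (use m in auto)
  obtain Bb where Bb: "\<And>s j. s \<in> {a..m} \<Longrightarrow> j < n \<Longrightarrow> \<bar>D j b s\<bar> \<le> Bb"
    by (rule D_bounded_on_far_edge[of b a m]) (use m in auto)
  obtain L where L: "0 \<le> L" and
    propagate: "\<And>s e t j B. s \<in> {a<..<b} \<Longrightarrow> e \<in> {a..b} - {s} \<Longrightarrow> (\<And>i. i < n \<Longrightarrow> \<bar>D i e s\<bar> \<le> B) \<Longrightarrow>
      t \<in> {a..b} - {s} \<Longrightarrow> j < n \<Longrightarrow> \<bar>D j t s\<bar> \<le> L * (1 + real n * (B + 1)\<^sup>2) + 1"
    using D_propagation_bound by blast
  define C0 where "C0 = max (L * (1 + real n * (Ba + 1)\<^sup>2) + 1) (L * (1 + real n * (Bb + 1)\<^sup>2) + 1)"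
  have low: "\<bar>D j t s\<bar> \<le> C0" if "s \<in> {a<..<b}" "t \<in> {a..b} - {s}" "j < n" for t s j
  proof (cases "s \<le> m")
    case True
    then have "\<bar>D j t s\<bar> \<le> L * (1 + real n * (Bb + 1)\<^sup>2) + 1"
      using that Bb m by (intro propagate[of s b]) auto
    then show ?thesis by (simp add: C0_def)
  next
    case False
    then have "\<bar>D j t s\<bar> \<le> L * (1 + real n * (Ba + 1)\<^sup>2) + 1"
      using that Ba m by (intro propagate[of s a]) auto
    then show ?thesis by (simp add: C0_def)
  qed
  obtain Q where Q: "0 \<le> Q" "\<And>t Y B. t \<in> {a..b} \<Longrightarrow> (\<And>j. j < n \<Longrightarrow> \<bar>Y j\<bar> \<le> B) \<Longrightarrow>
      \<bar>ode_rhs n c k M t Y\<bar> \<le> Q * B"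
    by (metis kn coeff ode_rhs_bound)
  show thesis
  proof
    fix t s j assume st: "s \<in> {a<..<b}" "t \<in> {a..b} - {s}" "j \<le> n"
    have "\<bar>D n t s\<bar> \<le> Q * C0"
      using D_ode[OF st(1,2)] Q(2)[of t "\<lambda>i. D i t s" C0] low st by auto
    then show "\<bar>D j t s\<bar> \<le> max C0 (Q * C0)"
      using low[OF st(1,2), of j] st(3) by (cases "j = n") auto
  qed
qed

lemma K_bounded:
  obtains C where "\<And>j t s. j \<le> n \<Longrightarrow> \<bar>K j t s\<bar> \<le> C"
proof -
  obtain C where C: "\<And>t s j. s \<in> {a<..<b} \<Longrightarrow> t \<in> {a..b} - {s} \<Longrightarrow> j \<le> n \<Longrightarrow> \<bar>D j t s\<bar> \<le> C"
    using D_bounded by blast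
  have "\<bar>K j t s\<bar> \<le> \<bar>C\<bar>" if "j \<le> n" for j t s
    using C[of s t j] that by (auto simp: green_ker_def off_diag_def)
  then show thesis using that by blast
qed

lemma K_eq: "s \<in> {a<..<b} \<Longrightarrow> t \<in> {a..b} - {s} \<Longrightarrow> K j t s = D j t s"
  by (auto simp: green_ker_def off_diag_def)

lemma K_measurable:
  assumes "j \<le> n"
  shows "(\<lambda>(t, s). K j t s) \<in> borel_measurable borel"
proof -
  have "continuous_on (off_diag a b) (\<lambda>(t, s). D j t s)"
    by (rule continuous_on_subset[OF D_continuous_off_diagonal[OF assms]]) (auto simp: off_diag_def)
  from borel_measurable_continuous_on_indicator[OF off_diag_borel this]
  have "(\<lambda>x. indicator (off_diag a b) x *\<^sub>R (case x of (t, s) \<Rightarrow> D j t s)) \<in> borel_measurable borel" .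
  also have "(\<lambda>x. indicator (off_diag a b) x *\<^sub>R (case x of (t, s) \<Rightarrow> D j t s)) = (\<lambda>(t, s). K j t s)"
    by (auto simp: green_ker_def indicator_def)
  finally show ?thesis .
qed

lemma K_section_measurable:
  assumes "j \<le> n"
  shows "(\<lambda>t. K j t s) \<in> borel_measurable borel" "(\<lambda>s. K j t s) \<in> borel_measurable borel"
proof -
  have *: "(\<lambda>(t, s). K j t s) \<in> borel_measurable (borel \<Otimes>\<^sub>M borel)"
    using K_measurable[OF assms] by (simp add: borel_prod)
  show "(\<lambda>t. K j t s) \<in> borel_measurable borel"
    using measurable_compose[OF _ *, of "\<lambda>t. (t, s)" borel] by simp
  show "(\<lambda>s. K j t s) \<in> borel_measurable borel"
    using measurable_compose[OF _ *, of "\<lambda>s. (t, s)" borel] by simp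
qed

lemma K_increment:
  assumes j: "j < n" and s: "s \<in> {a<..<b}" and t: "t \<in> {a..b} - {s}"
  shows "((\<lambda>x. K (Suc j) x s) has_integral K j t s - K j a s - jump j t s) {a..t}"
  using has_integral_spike_finite[OF _ _ D_increment[OF assms], of "{s}" "\<lambda>x. K (Suc j) x s"]
    K_eq[OF s] t s by auto

lemma K_ode:
  assumes "s \<in> {a<..<b}"
  shows "K n t s = ode_rhs n c k M t (\<lambda>j. K j t s)"
  using D_ode[OF assms, of t] assms
  by (auto simp: green_ker_def off_diag_def) (auto simp: ode_rhs_def)

end

section \<open>Potentials of a Green's function\<close>

context green_function
begin

text \<open>For continuous \<open>\<phi>\<close> the potential of order \<open>0\<close> is a solution of the boundary value problem with
  right-hand side \<open>\<phi>\<close>.  Below \<open>\<phi>\<close> is only a bounded Borel function, because the derivative of a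
  Green's function that takes its place jumps when \<open>k = n - 1\<close>; then the equation holds in integrated
  form.\<close>

definition potential :: "(real \<Rightarrow> real) \<Rightarrow> nat \<Rightarrow> real \<Rightarrow> real" where
  "potential \<phi> j t = integral {a..b} (\<lambda>r. K j t r * \<phi> r)"

lemma K_mult_integrable:
  assumes "j \<le> n" and "\<phi> \<in> borel_measurable borel" and "\<And>r. \<bar>\<phi> r\<bar> \<le> B"
  shows "(\<lambda>r. K j t r * \<phi> r) integrable_on {u..v}"
proof -
  obtain C where C: "\<And>j t s. j \<le> n \<Longrightarrow> \<bar>K j t s\<bar> \<le> C"
    using K_bounded by blast
  show ?thesis
  proof (rule bounded_borel_integrable_on)
    show "(\<lambda>r. K j t r * \<phi> r) \<in> borel_measurable borel"
      using K_section_measurable(2)[OF assms(1)] assms(2) by measurable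
    show "\<bar>K j t r * \<phi> r\<bar> \<le> C * B" for r
      unfolding abs_mult using C[OF assms(1), of t r] assms(3)[of r] by (intro mult_mono) auto
  qed
qed

text \<open>Fubini's theorem integrates the increment formula of the kernel against \<open>\<phi>\<close>.  The step contributes
  the integral of \<open>\<phi>\<close> over \<open>r < t\<close>, which is how the source term enters the equation in the top order.\<close>

lemma potential_increment:
  assumes j: "j < n" and t: "t \<in> {a..b}"
    and \<phi>: "\<phi> \<in> borel_measurable borel" and B: "\<And>r. \<bar>\<phi> r\<bar> \<le> B"
  shows "(potential \<phi> (Suc j) has_integral
      potential \<phi> j t - potential \<phi> j a - (if Suc j = n then integral {a..t} \<phi> else 0)) {a..t}"
proof -
  obtain C where C: "\<And>j t s. j \<le> n \<Longrightarrow> \<bar>K j t s\<bar> \<le> C"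
    using K_bounded by blast
  have meas: "(\<lambda>(x, r). K (Suc j) x r * \<phi> r) \<in> borel_measurable borel"
  proof -
    have "(\<lambda>(x, r). K (Suc j) x r) \<in> borel_measurable (borel \<Otimes>\<^sub>M borel)"
      using K_measurable[of "Suc j"] j by (simp add: borel_prod)
    then have "(\<lambda>z. (\<lambda>(x, r). K (Suc j) x r) z * \<phi> (snd z)) \<in> borel_measurable (borel \<Otimes>\<^sub>M borel)"
      using \<phi> by measurable
    then show ?thesis
      by (simp add: borel_prod case_prod_unfold)
  qed
  have "\<bar>K (Suc j) x r * \<phi> r\<bar> \<le> C * B" for x r
    unfolding abs_mult using C[of "Suc j" x r] B[of r] j by (intro mult_mono) auto
  from bounded_borel_Fubini[OF meas this, of a b a t]
  have "(potential \<phi> (Suc j) has_integral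
      integral {a..b} (\<lambda>r. integral {a..t} (\<lambda>x. K (Suc j) x r * \<phi> r))) {a..t}"
    by (simp add: potential_def[abs_def])
  also have "integral {a..b} (\<lambda>r. integral {a..t} (\<lambda>x. K (Suc j) x r * \<phi> r)) =
      integral {a..b} (\<lambda>r. K j t r * \<phi> r - K j a r * \<phi> r - jump j t r * \<phi> r)"
  proof (rule integral_spike[of "{a, b, t}"])
    fix r assume "r \<in> {a..b} - {a, b, t}"
    then have "integral {a..t} (\<lambda>x. K (Suc j) x r) = K j t r - K j a r - jump j t r"
      using t by (intro integral_unique K_increment j) auto
    then show "K j t r * \<phi> r - K j a r * \<phi> r - jump j t r * \<phi> r
        = integral {a..t} (\<lambda>x. K (Suc j) x r * \<phi> r)"
      by (simp add: left_diff_distrib)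
  qed simp
  also have "\<dots> = potential \<phi> j t - potential \<phi> j a - (if Suc j = n then integral {a..t} \<phi> else 0)"
  proof -
    have "\<phi> integrable_on {a..t}"
      by (rule bounded_borel_integrable_on[OF \<phi> B])
    then have restr: "((\<lambda>r. if r \<in> {a..t} then \<phi> r else 0) has_integral integral {a..t} \<phi>) {a..b}"
      using t by (subst has_integral_restrict) (auto simp: integrable_integral)
    have "((\<lambda>r. jump j t r * \<phi> r) has_integral (if Suc j = n then integral {a..t} \<phi> else 0)) {a..b}"
    proof (cases "Suc j = n")
      case True
      then have "jump j t r * \<phi> r = (if r \<in> {a..t} then \<phi> r else 0)" if "r \<in> {a..b} - {t}" for r
        using that by (auto simp: jump_def)
      then show ?thesis
        using has_integral_spike_finite[OF _ _ restr, of "{t}"] True by simp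
    qed (simp add: jump_def)
    moreover have "((\<lambda>r. K i x r * \<phi> r) has_integral potential \<phi> i x) {a..b}" if "i \<le> n" for i x
      unfolding potential_def using K_mult_integrable[OF that \<phi> B] by (rule integrable_integral)
    ultimately show ?thesis
      using j by (intro integral_unique has_integral_diff) auto
  qed
  finally show ?thesis .
qed

lemma potential_ode:
  assumes \<phi>: "\<phi> \<in> borel_measurable borel" and B: "\<And>r. \<bar>\<phi> r\<bar> \<le> B"
  shows "potential \<phi> n t = ode_rhs n c k M t (\<lambda>j. potential \<phi> j t)"
proof -
  have "potential \<phi> n t = integral {a..b}
      (\<lambda>r. - (\<Sum>i=1..n. c i t * (K (n - i) t r * \<phi> r)) - M * (K k t r * \<phi> r))"
    unfolding potential_def
  proof (rule integral_spike[of "{a, b}"])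
    fix r assume "r \<in> {a..b} - {a, b}"
    then show "- (\<Sum>i=1..n. c i t * (K (n - i) t r * \<phi> r)) - M * (K k t r * \<phi> r) = K n t r * \<phi> r"
      by (subst K_ode) (auto simp: ode_rhs_def sum_distrib_right left_diff_distrib mult.assoc)
  qed simp
  also have "\<dots> = ode_rhs n c k M t (\<lambda>j. potential \<phi> j t)"
    unfolding ode_rhs_def
  proof (rule integral_unique)
    have "((\<lambda>r. K i t r * \<phi> r) has_integral potential \<phi> i t) {a..b}" if "i \<le> n" for i
      unfolding potential_def using K_mult_integrable[OF that \<phi> B] by (rule integrable_integral)
    then show "((\<lambda>r. - (\<Sum>i=1..n. c i t * (K (n - i) t r * \<phi> r)) - M * (K k t r * \<phi> r)) has_integral
        - (\<Sum>i=1..n. c i t * potential \<phi> (n - i) t) - M * potential \<phi> k t) {a..b}"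
      using kn by (intro has_integral_diff has_integral_neg has_integral_sum has_integral_mult_right) auto
  qed
  finally show ?thesis .
qed

lemma K_boundary:
  assumes s: "s \<in> {a<..<b}" and i: "i \<in> {1..n}"
  shows "(\<Sum>j<n. \<alpha> i j * K j a s + \<beta> i j * K j b s) = 0"
  using D_boundary[OF assms] K_eq[OF s, of a] K_eq[OF s, of b] s by simp

lemma potential_boundary:
  assumes i: "i \<in> {1..n}" and \<phi>: "\<phi> \<in> borel_measurable borel" and B: "\<And>r. \<bar>\<phi> r\<bar> \<le> B"
  shows "(\<Sum>j<n. \<alpha> i j * potential \<phi> j a + \<beta> i j * potential \<phi> j b) = 0"
proof -
  have "((\<lambda>r. K i t r * \<phi> r) has_integral potential \<phi> i t) {a..b}" if "i \<le> n" for i t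
    unfolding potential_def using K_mult_integrable[OF that \<phi> B] by (rule integrable_integral)
  then have "((\<lambda>r. \<Sum>j<n. \<alpha> i j * (K j a r * \<phi> r) + \<beta> i j * (K j b r * \<phi> r)) has_integral
      (\<Sum>j<n. \<alpha> i j * potential \<phi> j a + \<beta> i j * potential \<phi> j b)) {a..b}"
    by (intro has_integral_sum has_integral_add has_integral_mult_right) auto
  moreover have "((\<lambda>r. \<Sum>j<n. \<alpha> i j * (K j a r * \<phi> r) + \<beta> i j * (K j b r * \<phi> r)) has_integral 0) {a..b}"
  proof (rule has_integral_spike_finite[of "{a, b}"])
    fix r assume "r \<in> {a..b} - {a, b}"
    then have "(\<Sum>j<n. \<alpha> i j * K j a r + \<beta> i j * K j b r) = 0"
      by (intro K_boundary i) auto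
    then have "(\<Sum>j<n. \<alpha> i j * K j a r + \<beta> i j * K j b r) * \<phi> r = 0"
      by simp
    then show "(\<Sum>j<n. \<alpha> i j * (K j a r * \<phi> r) + \<beta> i j * (K j b r * \<phi> r)) = 0"
      unfolding sum_distrib_right by (simp only: distrib_right mult.assoc)
  qed auto
  ultimately show ?thesis
    by (rule has_integral_unique)
qed

end

section \<open>Comparison of two parameters\<close>

text \<open>The function \<open>z\<close> is the difference of the two sides.  Both Green's functions jump by the same amount, so
  the steps cancel in \<open>z\<close>.  In top order the potential contributes the source \<open>\<phi> = \<partial>\<^sup>k g1 / \<partial>t\<^sup>k\<close>, and
  \<open>(M0 - M1) \<phi>\<close> is exactly the error made when \<open>g1\<close> is inserted in the equation with parameter \<open>M0\<close>.  Hence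
  \<open>z\<close> solves the homogeneous problem for \<open>M0\<close> in integrated form, and vanishes.\<close>

lemma green_difference_eq_potential:
  assumes g0: "green_function a b n k M0 c \<alpha> \<beta> g0" and g1: "green_function a b n k M1 c \<alpha> \<beta> g1"
    and uniq: "bvp_uniquely_solvable a b n c \<alpha> \<beta> k M0"
    and s: "s \<in> {a<..<b}" and t: "t \<in> {a..b} - {s}"
  shows "g1 t s = g0 t s + (M0 - M1) *
      integral {a..b} (\<lambda>r. green_ker a b 0 g0 t r * green_ker a b k g1 r s)"
proof -
  interpret G0: green_function a b n k M0 c \<alpha> \<beta> g0 by (rule g0)
  interpret G1: green_function a b n k M1 c \<alpha> \<beta> g1 by (rule g1)
  define \<phi> where "\<phi> r = green_ker a b k g1 r s" for r
  have \<phi>: "\<phi> \<in> borel_measurable borel"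
    unfolding \<phi>_def[abs_def] using G1.K_section_measurable(1)[of k] G1.kn by simp
  obtain B where "\<And>j t s. j \<le> n \<Longrightarrow> \<bar>green_ker a b j g1 t s\<bar> \<le> B"
    using G1.K_bounded by blast
  then have B: "\<bar>\<phi> r\<bar> \<le> B" for r
    using G1.kn by (simp add: \<phi>_def)
  \<comment> \<open>The source is added in order \<open>n\<close> only; this makes \<open>z n\<close> the integrand of the increment of \<open>z (n - 1)\<close>.\<close>
  define z where "z j x = green_ker a b j g1 x s - green_ker a b j g0 x s
      - (M0 - M1) * (G0.potential \<phi> j x + (if j = n then \<phi> x else 0))" for j x
  have "z 0 t = 0"
  proof (rule zero_of_homogeneous_integral_system[OF G0.ab G0.kn G0.coeff uniq s _ _ _ t])
    fix j x assume j: "j < n" and x: "x \<in> {a..b} - {s}"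
    have "(\<phi> has_integral integral {a..x} \<phi>) {a..x}"
      using bounded_borel_integrable_on[OF \<phi> B] by (rule integrable_integral)
    then have "((\<lambda>y. if Suc j = n then \<phi> y else 0) has_integral
        (if Suc j = n then integral {a..x} \<phi> else 0)) {a..x}"
      by auto
    from has_integral_diff[OF has_integral_diff[OF G1.K_increment[OF j s x] G0.K_increment[OF j s x]]
      has_integral_mult_right[OF has_integral_add[OF G0.potential_increment[OF j _ \<phi> B, of x] this], of "M0 - M1"]]
    show "(z (Suc j) has_integral z j x - z j a) {a..x}"
      using x j by (simp add: z_def[abs_def] G0.jump_def G1.jump_def algebra_simps)
  next
    fix x assume x: "x \<in> {a..b} - {s}"
    define S where "S Y = (\<Sum>i=1..n. c i x * Y (n - i))" for Y
    have Sz: "S (\<lambda>j. z j x) = S (\<lambda>j. green_ker a b j g1 x s) - S (\<lambda>j. green_ker a b j g0 x s)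
        - (M0 - M1) * S (\<lambda>j. G0.potential \<phi> j x)"
    proof -
      have "S (\<lambda>j. z j x) = (\<Sum>i=1..n. c i x * green_ker a b (n - i) g1 x s
          - c i x * green_ker a b (n - i) g0 x s - (M0 - M1) * (c i x * G0.potential \<phi> (n - i) x))"
        unfolding S_def by (rule sum.cong) (auto simp: z_def algebra_simps)
      then show ?thesis
        by (simp add: S_def sum_subtractf sum_distrib_left)
    qed
    have rhs: "ode_rhs n c k M x Y = - S Y - M * Y k" for M Y
      by (simp add: ode_rhs_def S_def)
    have zn: "z n x = green_ker a b n g1 x s - green_ker a b n g0 x s
        - (M0 - M1) * (G0.potential \<phi> n x + green_ker a b k g1 x s)"
      by (simp add: z_def \<phi>_def)
    have zk: "z k x = green_ker a b k g1 x s - green_ker a b k g0 x s - (M0 - M1) * G0.potential \<phi> k x"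
      using G0.kn by (simp add: z_def)
    show "z n x = ode_rhs n c k M0 x (\<lambda>j. z j x)"
      unfolding rhs Sz zn zk G0.K_ode[OF s, of x] G1.K_ode[OF s, of x] G0.potential_ode[OF \<phi> B, of x]
      by (simp add: algebra_simps)
  next
    fix i assume i: "i \<in> {1..n}"
    have "(\<Sum>j<n. \<alpha> i j * z j a + \<beta> i j * z j b) =
        (\<Sum>j<n. \<alpha> i j * green_ker a b j g1 a s + \<beta> i j * green_ker a b j g1 b s)
        - (\<Sum>j<n. \<alpha> i j * green_ker a b j g0 a s + \<beta> i j * green_ker a b j g0 b s)
        - (M0 - M1) * (\<Sum>j<n. \<alpha> i j * G0.potential \<phi> j a + \<beta> i j * G0.potential \<phi> j b)"
      unfolding sum_distrib_left sum_subtractf[symmetric]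
      by (rule sum.cong) (auto simp: z_def algebra_simps)
    then show "(\<Sum>j<n. \<alpha> i j * z j a + \<beta> i j * z j b) = 0"
      using G0.K_boundary[OF s i] G1.K_boundary[OF s i] G0.potential_boundary[OF i \<phi> B] by simp
  qed
  moreover have "z 0 t = g1 t s - g0 t s - (M0 - M1) * G0.potential \<phi> 0 t"
    unfolding z_def G0.K_eq[OF s t] G1.K_eq[OF s t] using G0.kn by (simp add: dt_def)
  ultimately have "g1 t s = g0 t s + (M0 - M1) * G0.potential \<phi> 0 t"
    by simp
  then show ?thesis
    by (simp only: G0.potential_def \<phi>_def)
qed

text \<open>Every \<open>(t, s)\<close> is a limit of pairs \<open>(t, S m)\<close> with \<open>S m\<close> in the open interval and different from \<open>t\<close>.  Both
  sides converge along such a sequence, the integral by dominated convergence thanks to the uniform bounds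
  on the kernels.  At a diagonal point the limit of \<open>g1 t (S m)\<close> is guaranteed to be
  \<open>g1 t t\<close> only if \<open>n \<ge> 2\<close>.\<close>

lemma green_identity:
  assumes g0: "green_function a b n k M0 c \<alpha> \<beta> g0" and g1: "green_function a b n k M1 c \<alpha> \<beta> g1"
    and uniq: "bvp_uniquely_solvable a b n c \<alpha> \<beta> k M0"
    and t: "t \<in> {a..b}" and s: "s \<in> {a..b}" and reg: "n = 1 \<longrightarrow> t \<noteq> s"
  shows "(\<lambda>r. g0 t r * dt a b k g1 r s) integrable_on {a..b}"
    and "g1 t s = g0 t s + (M0 - M1) * integral {a..b} (\<lambda>r. g0 t r * dt a b k g1 r s)"
proof -
  interpret G0: green_function a b n k M0 c \<alpha> \<beta> g0 by (rule g0)
  interpret G1: green_function a b n k M1 c \<alpha> \<beta> g1 by (rule g1)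
  have "s islimpt {a<..<b}"
    using islimpt_Icc[OF G0.ab, of s] limpt_of_closure[of s "{a<..<b}"] s G0.ab by simp
  then have "s islimpt ({t} \<union> ({a<..<b} - {t}))"
    by (rule islimpt_subset) auto
  then have "s islimpt ({a<..<b} - {t})"
    by (simp only: islimpt_Un_finite finite.intros)
  then obtain S where S: "\<And>m. S m \<in> {a<..<b} - {t}" and Slim: "S \<longlonglongrightarrow> s"
    unfolding islimpt_sequential by blast
  obtain C0 where "\<And>j t s. j \<le> n \<Longrightarrow> \<bar>green_ker a b j g0 t s\<bar> \<le> C0"
    using G0.K_bounded by blast
  then have C0: "\<bar>green_ker a b 0 g0 t r\<bar> \<le> C0" for r
    by simp
  obtain C1 where "\<And>j t s. j \<le> n \<Longrightarrow> \<bar>green_ker a b j g1 t s\<bar> \<le> C1"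
    using G1.K_bounded by blast
  then have C1: "\<bar>green_ker a b k g1 r s\<bar> \<le> C1" for r s
    using G1.kn by simp
  define f where "f m r = green_ker a b 0 g0 t r * green_ker a b k g1 r (S m)" for m r
  \<comment> \<open>The points \<open>t\<close> and \<open>s\<close>, where the integrands need not converge, are masked.\<close>
  define f' where "f' m r = (if r = t \<or> r = s then 0 else f m r)" for m r
  define h where "h r = (if r = t \<or> r = s then 0 else g0 t r * dt a b k g1 r s)" for r
  have f'_int: "f' m integrable_on {a<..<b}" and f'_eq: "integral {a<..<b} (f' m) = integral {a..b} (f m)" for m
  proof -
    have "f m integrable_on {a..b}"
      unfolding f_def
      by (rule G0.K_mult_integrable) (use G1.K_section_measurable(1)[of k] G1.kn C1 in auto)
    then show "f' m integrable_on {a<..<b}"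
      unfolding integrable_on_open_interval_real
      by (rule integrable_spike_finite[of "{t, s}", rotated 2]) (auto simp: f'_def)
    show "integral {a<..<b} (f' m) = integral {a..b} (f m)"
      unfolding integral_open_interval_real[symmetric]
      by (rule integral_spike[of "{t, s}"]) (auto simp: f'_def)
  qed
  have f'_bd: "norm (f' m r) \<le> C0 * C1" for m r
  proof -
    have "0 \<le> C0 * C1"
      using C0[of 0] C1[of 0 0] by (intro mult_nonneg_nonneg) linarith+
    moreover have "\<bar>f m r\<bar> \<le> C0 * C1"
      unfolding f_def abs_mult using C0[of r] C1[of r "S m"] by (intro mult_mono) auto
    ultimately show ?thesis
      by (simp add: f'_def)
  qed
  have f'_lim: "(\<lambda>m. f' m r) \<longlonglongrightarrow> h r" if r: "r \<in> {a<..<b}" for r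
  proof (cases "r = t \<or> r = s")
    case False
    have ev: "\<forall>\<^sub>F m in sequentially. S m \<noteq> r"
      using Slim False by (intro tendsto_imp_eventually_ne[of S s]) auto
    \<comment> \<open>Dropping finitely many terms keeps \<open>(r, S m)\<close> off the diagonal.\<close>
    then obtain N where N: "\<And>m. m \<ge> N \<Longrightarrow> S m \<noteq> r"
      by (auto simp: eventually_sequentially)
    have "(\<lambda>m. dt a b k g1 r (S (m + N))) \<longlonglongrightarrow> dt a b k g1 r s"
    proof (rule G1.D_tendsto)
      show "S (m + N) \<in> {a..b} - {r}" for m
        using S[of "m + N"] N[of "m + N"] by auto
      show "(\<lambda>m. S (m + N)) \<longlonglongrightarrow> s"
        using Slim by (rule LIMSEQ_ignore_initial_segment)
    qed (use r s False G1.kn in auto)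
    then have "(\<lambda>m. g0 t r * dt a b k g1 r (S (m + N))) \<longlonglongrightarrow> h r"
      using False by (simp add: h_def tendsto_mult)
    moreover have "f' (m + N) r = g0 t r * dt a b k g1 r (S (m + N))" for m
      using G0.K_eq[of r t 0] G1.K_eq[of "S (m + N)" r k] S[of "m + N"] N[of "m + N"] r t False
      by (auto simp: f'_def f_def dt_def)
    ultimately have "(\<lambda>m. f' (m + N) r) \<longlonglongrightarrow> h r"
      by simp
    then show ?thesis
      by (rule LIMSEQ_offset)
  qed (auto simp: f'_def h_def)
  have const: "(\<lambda>_. C0 * C1) integrable_on {a<..<b}"
    unfolding integrable_on_open_interval_real by (rule integrable_const_ivl)
  note dom = dominated_convergence[OF f'_int const f'_bd f'_lim]
  show "(\<lambda>r. g0 t r * dt a b k g1 r s) integrable_on {a..b}"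
  proof (rule integrable_spike_finite[of "{t, s}"])
    show "h integrable_on {a..b}"
      using dom(1) by (simp only: integrable_on_open_interval_real)
  qed (auto simp: h_def)
  have h_eq: "integral {a<..<b} h = integral {a..b} (\<lambda>r. g0 t r * dt a b k g1 r s)"
    unfolding integral_open_interval_real[symmetric]
    by (rule integral_spike[of "{t, s}"]) (auto simp: h_def)
  have S': "S m \<in> {a..b} - {t}" for m
    using S[of m] by auto
  have "(\<lambda>m. dt a b 0 g0 t (S m) + (M0 - M1) * integral {a<..<b} (f' m)) \<longlonglongrightarrow>
      dt a b 0 g0 t s + (M0 - M1) * integral {a<..<b} h"
    by (intro tendsto_intros G0.D_tendsto dom(2) S' Slim t s) (use reg G0.kn in auto)
  moreover have "dt a b 0 g0 t (S m) + (M0 - M1) * integral {a<..<b} (f' m) = dt a b 0 g1 t (S m)" for m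
    using green_difference_eq_potential[OF g0 g1 uniq, of "S m" t] S[of m] t
    by (auto simp: f'_eq f_def[abs_def] dt_def)
  ultimately have "(\<lambda>m. dt a b 0 g1 t (S m)) \<longlonglongrightarrow> dt a b 0 g0 t s + (M0 - M1) * integral {a<..<b} h"
    by simp
  moreover have "(\<lambda>m. dt a b 0 g1 t (S m)) \<longlonglongrightarrow> dt a b 0 g1 t s"
    by (intro G1.D_tendsto S' Slim t s) (use reg G1.kn in auto)
  ultimately have "dt a b 0 g1 t s = dt a b 0 g0 t s + (M0 - M1) * integral {a<..<b} h"
    using LIMSEQ_unique by blast
  then show "g1 t s = g0 t s + (M0 - M1) * integral {a..b} (\<lambda>r. g0 t r * dt a b k g1 r s)"
    by (simp add: h_eq dt_def)
qed

theorem theorem2p2: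
  fixes a b M0 M1 :: real and n k :: nat
    and c :: "nat \<Rightarrow> real \<Rightarrow> real"
    and \<alpha> \<beta> :: "nat \<Rightarrow> nat \<Rightarrow> real"
    and g0 g1 :: "real \<Rightarrow> real \<Rightarrow> real"
  assumes "a < b" and "k < n"
    and "\<And>i. i \<in> {1..n} \<Longrightarrow> continuous_on {a..b} (c i)"
    and "bvp_uniquely_solvable a b n c \<alpha> \<beta> k M0"
    and "bvp_uniquely_solvable a b n c \<alpha> \<beta> k M1"
    and "is_green a b n c \<alpha> \<beta> k M0 g0"
    and "is_green a b n c \<alpha> \<beta> k M1 g1"
  shows "\<forall>t\<in>{a..b}. \<forall>s\<in>{a..b}. (n = 1 \<longrightarrow> t \<noteq> s) \<longrightarrow>
      (\<lambda>r. g0 t r * dt a b k g1 r s) integrable_on {a..b} \<and>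
      g1 t s = g0 t s + (M0 - M1) * integral {a..b} (\<lambda>r. g0 t r * dt a b k g1 r s) \<and>
      (\<lambda>r. g1 t r * dt a b k g0 r s) integrable_on {a..b} \<and>
      g1 t s = g0 t s + (M0 - M1) * integral {a..b} (\<lambda>r. g1 t r * dt a b k g0 r s)"
proof (intro ballI impI)
  fix t s assume ts: "t \<in> {a..b}" "s \<in> {a..b}" "n = 1 \<longrightarrow> t \<noteq> s"
  have g0: "green_function a b n k M0 c \<alpha> \<beta> g0" and g1: "green_function a b n k M1 c \<alpha> \<beta> g1"
    using assms by (auto intro!: green_function.intro)
  \<comment> \<open>The second identity is the first one with the roles of \<open>M0\<close> and \<open>M1\<close> exchanged.\<close>
  note id01 = green_identity[OF g0 g1 assms(4) ts] and id10 = green_identity[OF g1 g0 assms(5) ts]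
  have "g1 t s = g0 t s + (M0 - M1) * integral {a..b} (\<lambda>r. g1 t r * dt a b k g0 r s)"
    using id10(2) by (simp add: left_diff_distrib)
  with id01 id10(1) show "(\<lambda>r. g0 t r * dt a b k g1 r s) integrable_on {a..b} \<and>
      g1 t s = g0 t s + (M0 - M1) * integral {a..b} (\<lambda>r. g0 t r * dt a b k g1 r s) \<and>
      (\<lambda>r. g1 t r * dt a b k g0 r s) integrable_on {a..b} \<and>
      g1 t s = g0 t s + (M0 - M1) * integral {a..b} (\<lambda>r. g1 t r * dt a b k g0 r s)"
    by blast
qed

end
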